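(* For every positive integer $n$, the number $P(n,2)$ of two-ball prime juggling patterns of period $n$ satisfies \[ P(n,2)=\sum_{t\ge 1}\bigg(\sum_{\substack{p_1>\cdots>p_t \ge 1 \\ p_1+\cdots+p_t=n}}\frac{1}{t(t+1)}\prod_{i=1}^t\bigg(\frac{i+1}{i}\bigg)^{p_i}\bigg), \] where the inner sum is over strictly decreasing sequences of positive integers $p_1>\cdots>p_t$ summing to $n$ (i.e. partitions of $n$ into $t$ distinct parts).
   Context: For an integer $b\ge 1$, the state graph for $b$ balls is the infinite directed graph whose vertices (states) are the infinite $0$-$1$ sequences $\mathbf{c}=\langle c_1,c_2,\ldots\rangle$ (indexed by positive integers) containing exactly $b$ entries equal to $1$, with a directed edge $\mathbf{c}\to\mathbf{d}$ if and only if $d_i\ge c_{i+1}$ for all $i\ge 1$ (loops allowed). A prime juggling pattern of period $n$ with $b$ balls is a directed cycle of length $n$ in this graph, i.e. a closed walk $v_0\to v_1\to\cdots\to v_n=v_0$ with $v_0,\ldots,v_{n-1}$ pairwise distinct, where closed walks differing only by a cyclic shift of the starting point are identified (so a loop is a cycle of length $1$). $P(n,b)$ denotes the number of such cycles of length $n$. *)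

theory Defs
  imports "HOL-Analysis.Infinite_Sum" "Graph_Theory.Digraph" "Graph_Theory.Arc_Walk"
begin

text \<open>
  Sequences are indexed from 0 here: the entry c i is the entry of the state with
  (1-based) index i + 1.
\<close>

definition juggling_states :: "nat \<Rightarrow> (nat \<Rightarrow> nat) set" where
  "juggling_states b = {c. range c \<subseteq> {0, 1} \<and> finite {i. c i = 1} \<and> card {i. c i = 1} = b}"

definition state_graph :: "nat \<Rightarrow> (nat \<Rightarrow> nat, (nat \<Rightarrow> nat) \<times> (nat \<Rightarrow> nat)) pre_digraph" where
  "state_graph b =
     \<lparr> verts = juggling_states b,
       arcs = {(c, d). c \<in> juggling_states b \<and> d \<in> juggling_states b \<and> (\<forall>i. d i \<ge> c (Suc i))},
       tail = fst,
       head = snd \<rparr>"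

text \<open>
  The library's \<^const>\<open>pre_digraph.cycle\<close> describes a based cycle by its nonempty list of arcs,
  whose end vertices are pairwise distinct; a loop is a cycle of length 1.
\<close>

definition based_cycles :: "nat \<Rightarrow> nat \<Rightarrow> ((nat \<Rightarrow> nat) \<times> (nat \<Rightarrow> nat)) list set" where
  "based_cycles n b = {p. pre_digraph.cycle (state_graph b) p \<and> length p = n}"

definition cyclic_shift :: "('a list \<times> 'a list) set" where
  "cyclic_shift = {(p, q). \<exists>k. q = rotate k p}"

definition prime_juggling_patterns ::
    "nat \<Rightarrow> nat \<Rightarrow> ((nat \<Rightarrow> nat) \<times> (nat \<Rightarrow> nat)) list set set" where
  "prime_juggling_patterns n b = based_cycles n b // cyclic_shift"

text \<open>
  The cardinality of an infinite set is 0 in HOL; a positive value of the following function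
  therefore also says that there are only finitely many patterns.
\<close>

definition num_prime_juggling_patterns :: "nat \<Rightarrow> nat \<Rightarrow> nat" where
  "num_prime_juggling_patterns n b = card (prime_juggling_patterns n b)"

definition distinct_partitions :: "nat \<Rightarrow> nat \<Rightarrow> nat list set" where
  "distinct_partitions n t =
     {p. length p = t \<and> sorted_wrt (>) p \<and> (\<forall>x\<in>set p. x \<ge> 1) \<and> sum_list p = n}"

end

theory Submission
  imports Defs
begin

text \<open>
  A state with a ball about to land is determined by the height \<open>j\<close> of the other ball, and all other
  moves are forced. Hence a cycle is a cyclic sequence of distinct heights, where the passage from
  \<open>j\<close> to \<open>m\<close> takes \<open>j\<close> steps or, if \<open>m < j\<close>, alternatively \<open>j - m\<close> steps. Summing around the cycle,
  the period is the sum of the heights that are not reached by a passage of the second kind, so these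
  form a partition \<open>p\<^sub>1 > \<dots> > p\<^sub>t\<close> of \<open>n\<close> into distinct parts. For a fixed partition the cycles are built by inserting
  the heights in decreasing order: a part can be inserted in front of any earlier part, and a number
  that is not a part can be omitted or inserted in front of any part larger than itself. This gives
  \<open>(t - 1)! \<Prod>\<^sub>d (1 + #{i. p\<^sub>i > d})\<close> cycles, \<open>d\<close> ranging over the numbers below \<open>p\<^sub>1\<close> that are not parts,
  which is \<open>(1 / (t (t + 1))) \<Prod>\<^sub>i ((i + 1) / i) ^ p\<^sub>i\<close>.
\<close>

section \<open>Counting words with prescribed parts\<close>

text \<open>
  A letter \<open>(m, b)\<close> of a word stands for an arrival in the state with a ball about to land and the
  other ball at height \<open>m\<close>; \<open>b\<close> tells whether the previous such height \<open>j\<close> was used up completely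
  (\<open>j\<close> time steps) or not (\<open>j - m\<close> time steps, possible only if \<open>m < j\<close>). Only the
  letters with \<open>b\<close> true, the parts, contribute to the period.
\<close>

definition linked :: "(nat \<times> bool) list \<Rightarrow> bool" where
  "linked = successively (\<lambda>x y. snd y \<or> fst y < fst x)"

text \<open>The word is read cyclically and cut after its largest letter \<open>(M, True)\<close>;
  putting this letter in front as well makes \<open>linked\<close> cover the closing passage. The
  bound \<open>k\<close> restricts only the letters that are not parts, so lowering it admits one
  further height at a time.\<close>

definition words :: "nat \<Rightarrow> nat set \<Rightarrow> nat \<Rightarrow> (nat \<times> bool) list set" where
  "words M P k = {w. w \<noteq> [] \<and> last w = (M, True) \<and> linked ((M, True) # w) \<and>
     distinct (map fst w) \<and> (\<forall>x\<in>set w. fst x \<le> M) \<and> {m. (m, True) \<in> set w} = P \<and>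
     (\<forall>m. (m, False) \<in> set w \<longrightarrow> k \<le> m)}"

definition insert_word :: "nat \<times> bool \<Rightarrow> (nat \<times> bool) list \<times> nat \<Rightarrow> (nat \<times> bool) list" where
  "insert_word x = (\<lambda>(w, i). take i w @ x # drop i w)"

definition slots :: "(nat \<times> bool) list \<Rightarrow> nat set" where
  "slots w = {i. i < length w \<and> snd (w ! i)}"

lemma finite_slots: "finite (slots w)"
  unfolding slots_def by simp

lemma card_slots:
  assumes "w \<in> words M P k"
  shows "card (slots w) = card P"
proof -
  have d: "distinct (map fst w)" and P: "{m. (m, True) \<in> set w} = P"
    using assms by (auto simp: words_def)
  have "card (slots w) = length (filter snd w)"
    by (simp add: slots_def length_filter_conv_card)
  also have "\<dots> = card (set (map fst (filter snd w)))"
    using d by (metis distinct_card distinct_map_filter length_map)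
  also have "set (map fst (filter snd w)) = P"
    using P by force
  finally show ?thesis .
qed

lemma words_ge:
  assumes "w \<in> words M P k" "P \<subseteq> {k..}" "x \<in> set w"
  shows "k \<le> fst x"
  using assms by (cases x; cases "snd x") (auto simp: words_def)

text \<open>
  A new smallest letter fits exactly in front of the parts: its predecessor is larger anyway, while
  a successor that is not a part would have to be smaller than it.
\<close>

lemma insert_word_in_words:
  assumes P: "P \<subseteq> {Suc k..}" and w: "w \<in> words M P (Suc k)" and i: "i \<in> slots w"
  shows "insert_word (k, b) (w, i) \<in> words M (if b then insert k P else P) k"
proof -
  have ne: "drop i w \<noteq> []" and s: "snd (hd (drop i w))"
    using i by (auto simp: slots_def hd_drop_conv_nth)
  have ge: "\<And>x. x \<in> set w \<Longrightarrow> Suc k \<le> fst x"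
    using words_ge[OF w P] .
  have MP: "(M, True) \<in> set w"
    using w last_in_set[of w] by (auto simp: words_def)
  then have kM: "Suc k \<le> M"
    using ge by force
  have l: "linked (((M, True) # take i w) @ drop i w)"
    using w by (simp add: words_def)
  \<comment> \<open>For an insertion at the front the predecessor is the prefixed
    \<open>(M, True)\<close>, hence the appeal to \<open>kM\<close>.\<close>
  have gl: "k < fst (last ((M, True) # take i w))"
    using ge kM by (metis Suc_le_eq fst_conv in_set_takeD last_in_set list.distinct(1) set_ConsD)
  have "linked (((M, True) # take i w) @ (k, b) # drop i w)"
    using l ne s gl unfolding linked_def successively_append_iff successively_Cons by simp
  moreover have st: "set (take i w) \<union> set (drop i w) = set w"
    by (metis append_take_drop_id set_append)
  moreover have "distinct (map fst (take i w)) \<and> distinct (map fst (drop i w)) \<and>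
      fst ` set (take i w) \<inter> fst ` set (drop i w) = {}"
  proof -
    have "distinct (map fst (take i w @ drop i w))"
      using w by (simp add: words_def)
    then show ?thesis
      unfolding map_append distinct_append by simp
  qed
  moreover have "k \<notin> fst ` set w"
    using ge by force
  moreover have "last (drop i w) = (M, True)"
    using w i by (simp add: words_def slots_def)
  ultimately show ?thesis
    using w ne kM unfolding insert_word_def words_def
    by (auto dest: in_set_takeD in_set_dropD)
qed

text \<open>Inverts the insertion. The letter of height \<open>k\<close> is not the last one because
  \<open>k < M\<close>. Its successor is not smaller, so it must be a part, and a part may follow
  any letter; deleting the letter therefore keeps the word linked.\<close>

lemma words_remove:
  assumes P: "P \<subseteq> {Suc k..}" and M: "M \<in> P"
    and w: "w \<in> words M (if b then insert k P else P) k" and k: "(k, b) \<in> set w"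
  shows "\<exists>v\<in>words M P (Suc k). \<exists>i\<in>slots v. w = insert_word (k, b) (v, i)"
proof -
  obtain x y where xy: "w = x @ (k, b) # y"
    using k by (meson split_list)
  have Pb: "(if b then insert k P else P) \<subseteq> {k..}"
    using P by auto
  have ge: "\<And>z. z \<in> set w \<Longrightarrow> k \<le> fst z"
    using words_ge[OF w Pb] .
  have l: "last w = (M, True)" "linked ((M, True) # w)" "distinct (map fst w)" "\<forall>x\<in>set w. fst x \<le> M"
    and T: "{m. (m, True) \<in> set w} = (if b then insert k P else P)"
    using w by (auto simp: words_def)
  have "k < M" using P M by auto
  then have y: "y \<noteq> []"
    using l(1) xy by auto
  then have "k \<le> fst (hd y)"
    using ge xy by simp
  moreover have lx: "linked (((M, True) # x) @ (k, b) # y)"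
    using l(2) xy by simp
  ultimately have s: "snd (hd y)"
    using y unfolding linked_def successively_append_iff successively_Cons by auto
  have "linked (((M, True) # x) @ y)"
    using lx s y unfolding linked_def successively_append_iff successively_Cons by auto
  moreover have "(k, c) \<notin> set (x @ y)" for c
    using l(3) xy by (force)
  moreover have "{m. (m, True) \<in> set (x @ y)} = P"
  proof -
    have "k \<notin> P" using P by auto
    moreover have "{m. (m, True) \<in> set (x @ y)} = {m. (m, True) \<in> set w} - {k}"
      using xy \<open>\<And>c. (k, c) \<notin> set (x @ y)\<close> by auto
    ultimately show ?thesis using T by auto
  qed
  moreover have "Suc k \<le> m" if "(m, False) \<in> set (x @ y)" for m
  proof -
    have "k \<le> m" using ge that xy by force
    moreover have "m \<noteq> k" using that \<open>\<And>c. (k, c) \<notin> set (x @ y)\<close> by blast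
    ultimately show ?thesis by simp
  qed
  ultimately have "x @ y \<in> words M P (Suc k)"
    using l y xy unfolding words_def by auto
  moreover have "length x \<in> slots (x @ y)"
    using y s by (auto simp: slots_def nth_append hd_conv_nth)
  ultimately show ?thesis
    using xy by (intro bexI[of _ "x @ y"] bexI[of _ "length x"]) (auto simp: insert_word_def)
qed

text \<open>All letters of the shorter words have height above \<open>k\<close>, so the inserted
  letter can be located in the result.\<close>

lemma insert_word_inj:
  assumes "P \<subseteq> {Suc k..}"
  shows "inj_on (insert_word (k, b)) (SIGMA w:words M P (Suc k). slots w)"
proof (rule inj_onI, clarify)
  fix v i w j
  assume v: "v \<in> words M P (Suc k)" "i \<in> slots v" and w: "w \<in> words M P (Suc k)" "j \<in> slots w"
    and e: "insert_word (k, b) (v, i) = insert_word (k, b) (w, j)"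
  have n: "(k, b) \<notin> set v" "(k, b) \<notin> set w"
    using words_ge[OF v(1) assms] words_ge[OF w(1) assms] by force+
  have "take i v @ (k, b) # drop i v = take j w @ (k, b) # drop j w"
    using e by (simp add: insert_word_def)
  then have "take i v = take j w \<and> drop i v = drop j w"
    using n by (subst (asm) append_Cons_eq_iff) (auto dest: in_set_takeD in_set_dropD)
  moreover have "i = length (take i v)" "j = length (take j w)"
    using v w by (auto simp: slots_def)
  ultimately show "v = w \<and> i = j"
    by (metis append_take_drop_id)
qed

text \<open>Insertion is a bijection from pairs of a word and a slot, and there are
  \<open>card P\<close> slots. The conditional lets one statement serve both a new part and a new
  height that is not a part.\<close>

lemma card_words_insert:
  assumes "P \<subseteq> {Suc k..}" "M \<in> P" "finite (words M P (Suc k))"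
  shows "finite {w \<in> words M (if b then insert k P else P) k. (k, b) \<in> set w}"
    and "card {w \<in> words M (if b then insert k P else P) k. (k, b) \<in> set w}
      = card P * card (words M P (Suc k))"
proof -
  have e: "{w \<in> words M (if b then insert k P else P) k. (k, b) \<in> set w}
      = insert_word (k, b) ` (SIGMA w:words M P (Suc k). slots w)" (is "?L = ?R")
  proof
    show "?L \<subseteq> ?R"
      using words_remove[OF assms(1,2)] by fast
    show "?R \<subseteq> ?L"
      using insert_word_in_words[OF assms(1)] by (fastforce simp: insert_word_def)
  qed
  show "finite ?L"
    unfolding e using assms(3) finite_slots by blast
  have "card ?L = (\<Sum>w\<in>words M P (Suc k). card (slots w))"
    unfolding e card_image[OF insert_word_inj[OF assms(1)]]
    using assms(3) finite_slots by simp
  then show "card ?L = card P * card (words M P (Suc k))"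
    using card_slots by simp
qed

lemma card_words_new_part:
  assumes "P \<subseteq> {Suc k..}" "M \<in> P" "finite (words M P (Suc k))"
  shows "finite (words M (insert k P) k) \<and> card (words M (insert k P) k) = card P * card (words M P (Suc k))"
proof -
  have "{w \<in> words M (insert k P) k. (k, True) \<in> set w} = words M (insert k P) k"
    by (auto simp: words_def)
  then show ?thesis
    using card_words_insert[OF assms, of True] by simp
qed

text \<open>Since \<open>k\<close> is not a part, it may also be omitted; this adds one to the
  \<open>card P\<close> ways of inserting it.\<close>

lemma card_words_lower:
  assumes "P \<subseteq> {Suc k..}" "M \<in> P" "finite (words M P (Suc k))"
  shows "finite (words M P k) \<and> card (words M P k) = Suc (card P) * card (words M P (Suc k))"
proof -
  let ?D = "{w \<in> words M P k. (k, False) \<in> set w}"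
  have "words M P k = words M P (Suc k) \<union> ?D"
    by (auto simp: words_def Suc_le_eq order_le_less)
  moreover have "words M P (Suc k) \<inter> ?D = {}"
    by (auto simp: words_def)
  ultimately show ?thesis
    using card_words_insert[OF assms, of False] assms(3)
    by (metis (no_types, lifting) card_Un_disjoint finite_Un mult_Suc)
qed

lemma words_single: "words M {M} M = {[(M, True)]}"
proof -
  have "w = [(M, True)]" if "w \<in> words M {M} M" for w
  proof -
    have *: "x = (M, True)" if "x \<in> set w" for x
    proof -
      have "M \<le> fst x" "fst x \<le> M"
        using words_ge[OF \<open>w \<in> words M {M} M\<close>] \<open>w \<in> words M {M} M\<close> that by (auto simp: words_def)
      then have "fst x = M" by simp
      moreover have "(M, True) \<in> set w" "distinct (map fst w)"
        using \<open>w \<in> words M {M} M\<close> last_in_set[of w] by (auto simp: words_def)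
      ultimately show ?thesis
        using that by (metis distinct_map fst_conv inj_onD)
    qed
    have "distinct w" "w \<noteq> []"
      using that by (auto simp: words_def distinct_map)
    then show ?thesis
      using * by (cases w rule: list.exhaust; cases "tl w") auto
  qed
  then show ?thesis
    by (auto simp: words_def linked_def)
qed

section \<open>The product formula for the number of words\<close>

definition weight :: "nat list \<Rightarrow> real" where
  "weight p = (\<Prod>i=1..length p. ((real i + 1) / real i) ^ (p ! (i - 1)))"

lemma weight_snoc:
  "weight (p @ [q]) = weight p * ((real (length p) + 2) / (real (length p) + 1)) ^ q"
proof -
  have "(\<Prod>i=1..length p. ((real i + 1) / real i) ^ ((p @ [q]) ! (i - 1))) = weight p"
    unfolding weight_def by (rule prod.cong) (auto simp: nth_append)
  then show ?thesis
    by (simp add: weight_def add.commute)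
qed

lemma card_words_le:
  assumes "P \<subseteq> {j..}" "M \<in> P" "finite (words M P j)" "k \<le> j"
  shows "finite (words M P k) \<and> card (words M P k) = Suc (card P) ^ (j - k) * card (words M P j)"
  using assms(4)
proof (induction k rule: inc_induct)
  case base
  then show ?case using assms by simp
next
  case (step k)
  have "P \<subseteq> {Suc k..}" using assms(1) step by auto
  from card_words_lower[OF this assms(2)] step show ?case
    by (simp add: Suc_diff_Suc[symmetric, of k j] algebra_simps del: Suc_diff_Suc)
qed

lemma sorted_wrt_greater_distinct: "sorted_wrt (>) p \<Longrightarrow> distinct p" for p :: "nat list"
  by (induction p) auto

text \<open>
  The factor \<open>(t + 1)^(k - 1)\<close> stands for the numbers below \<open>k\<close> that have not been considered yet:
  each of them could still be omitted or be inserted in front of one of the \<open>t\<close> parts.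
\<close>

lemma card_words:
  assumes "p \<noteq> []" "sorted_wrt (>) p" "\<forall>x\<in>set p. x \<ge> 1" "1 \<le> k" "k \<le> last p"
  shows "finite (words (hd p) (set p) k) \<and>
    real (card (words (hd p) (set p) k)) * (real (length p) + 1) ^ (k - 1)
      = 1 / (real (length p) * (real (length p) + 1)) * weight p"
  using assms
proof (induction p arbitrary: k rule: rev_induct)
  case Nil
  then show ?case by simp
next
  case (snoc q p)
  let ?t = "real (length p)"
  have q: "1 \<le> q" "k \<le> q" using snoc.prems by auto
  \<comment> \<open>It suffices to treat \<open>k = q\<close>: lowering the bound to
    \<open>k\<close> multiplies the count by \<open>(?t + 2) ^ (q - k)\<close> and lowers the
    exponent of the other factor by the same amount. Here \<open>?t\<close> counts the parts without
    \<open>q\<close>.\<close>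
  have gen: ?case if fin: "finite (words (hd (p @ [q])) (set (p @ [q])) q)"
    and c: "real (card (words (hd (p @ [q])) (set (p @ [q])) q)) * (?t + 2) ^ (q - 1)
      = 1 / ((?t + 1) * (?t + 2)) * weight (p @ [q])"
  proof -
    let ?M = "hd (p @ [q])" and ?P = "set (p @ [q])"
    have "?P \<subseteq> {q..}" "?M \<in> ?P"
      using snoc.prems(2) hd_in_set[of "p @ [q]"] by (auto simp: sorted_wrt_append less_imp_le simp del: hd_in_set)
    note l = card_words_le[OF this fin q(2)]
    have "card ?P = Suc (length p)"
      using snoc.prems(2) distinct_card[of "p @ [q]"]
        sorted_wrt_greater_distinct[of "p @ [q]"] by simp
    then have "real (card (words ?M ?P k)) = (?t + 2) ^ (q - k) * real (card (words ?M ?P q))"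
      using l by (simp add: add.commute)
    moreover have "q - 1 = (q - k) + (k - 1)"
      using q snoc.prems(4) by simp
    ultimately show ?thesis
      using c conjunct1[OF l] by (simp add: power_add algebra_simps)
  qed
  show ?case
  proof (cases "p = []")
    case True
    \<comment> \<open>For the single part \<open>q\<close> the identity reads
      \<open>2 ^ (q - 1) = 1 / 2 * 2 ^ q\<close>.\<close>
    then show ?thesis
      using gen words_single[of q] q by (simp add: weight_def power_eq_if)
  next
    case False
    have lp: "q < last p"
      using snoc.prems(2) False by (simp add: sorted_wrt_append)
    have s: "sorted_wrt (>) p" "\<forall>x\<in>set p. x \<ge> 1"
      using snoc.prems by (auto simp: sorted_wrt_append)
    \<comment> \<open>The bound \<open>Suc q\<close> leaves the heights from 1 to \<open>q\<close>
      undecided, hence the exponent \<open>q\<close>.\<close>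
    have IH: "finite (words (hd p) (set p) (Suc q))"
      "real (card (words (hd p) (set p) (Suc q))) * (?t + 1) ^ q = 1 / (?t * (?t + 1)) * weight p"
      using snoc.IH[OF False s, of "Suc q"] lp by auto
    have "set p \<subseteq> {Suc q..}" "hd p \<in> set p"
      using snoc.prems(2) False by (auto simp: sorted_wrt_append Suc_le_eq)
    note new = card_words_new_part[OF this IH(1)]
    have "card (set p) = length p"
      using s distinct_card sorted_wrt_greater_distinct by blast
    then have c: "real (card (words (hd p) (insert q (set p)) q))
        = ?t * real (card (words (hd p) (set p) (Suc q)))"
      using new by simp
    have t: "?t > 0" using False by simp
    have w: "weight p = ?t * (?t + 1) * (real (card (words (hd p) (set p) (Suc q))) * (?t + 1) ^ q)"
      using t by (subst IH(2)) (simp add: mult_pos_pos less_imp_neq[symmetric])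
    \<comment> \<open>The factor from \<open>weight_snoc\<close> trades \<open>(?t + 1) ^ q\<close>
      for \<open>(?t + 2) ^ q\<close>, and one \<open>?t + 2\<close> cancels against the new
      denominator.\<close>
    have "(?t + 2) ^ q = (?t + 2) * (?t + 2) ^ (q - 1)"
      using q by (simp add: power_eq_if)
    then show ?thesis
      using False conjunct1[OF new] t by (intro gen) (simp_all add: c w weight_snoc power_divide)
  qed
qed

section \<open>Words and closed walks\<close>

text \<open>
  The pair \<open>(a, m)\<close> with \<open>m \<ge> 1\<close> encodes the state whose two entries 1 have the indices
  \<open>a\<close> and \<open>a + m\<close>.
\<close>

fun step :: "nat \<times> nat \<Rightarrow> nat \<times> nat \<Rightarrow> bool" where
  "step (a, m) (a', m') \<longleftrightarrow> m' \<ge> 1 \<and>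
     (if a = 0 then m = Suc a' \<or> m = Suc (a' + m') else a = Suc a' \<and> m' = m)"

text \<open>The states visited after \<open>(0, j)\<close> up to and including the next state of the form \<open>(0, m)\<close>.\<close>

definition segment :: "nat \<Rightarrow> nat \<times> bool \<Rightarrow> (nat \<times> nat) list" where
  "segment j x = map (\<lambda>i. (i, fst x)) (rev [0..<(if snd x then j else j - fst x)])"

text \<open>The start \<open>(0, j)\<close> is left out and the final state is kept, so that a
  closed walk lists its base point once.\<close>

fun walk_of :: "nat \<Rightarrow> (nat \<times> bool) list \<Rightarrow> (nat \<times> nat) list" where
  "walk_of j [] = []"
| "walk_of j (x # w) = segment j x @ walk_of (fst x) w"

lemma linked_Cons2: "linked (x # y # w) \<longleftrightarrow> (snd y \<or> fst y < fst x) \<and> linked (y # w)"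
  by (simp add: linked_def)

lemma linked_single: "linked [x]"
  by (simp add: linked_def)

text \<open>A segment is as long as the previous height, less the new height if the new letter is
  not a part; \<open>linked\<close> keeps this subtraction from being truncated. In the sum over the
  word the heights that are not parts cancel.\<close>

lemma length_walk_of:
  assumes "linked ((j, b) # w)" "w \<noteq> []"
  shows "length (walk_of j w) + fst (last w) = j + sum_list (map fst (filter snd w))"
  using assms
proof (induction w arbitrary: j b)
  case (Cons x w)
  obtain m c where x: "x = (m, c)" by (cases x)
  have c: "c \<or> m < j" and l: "linked ((m, c) # w)"
    using Cons.prems(1) by (auto simp: x linked_Cons2)
  show ?case
  proof (cases "w = []")
    case True
    then show ?thesis using c by (auto simp: x segment_def)
  next
    case False
    then show ?thesis
      using Cons.IH[OF l False] c by (auto simp: x segment_def)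
  qed
qed simp

text \<open>By \<open>linked\<close> no segment is empty, and each contains exactly one state with
  lower index 0, namely its last.\<close>

lemma map_snd_filter_walk_of:
  assumes "linked ((j, b) # w)" "j \<ge> 1" "\<forall>x\<in>set w. fst x \<ge> 1"
  shows "map snd (filter (\<lambda>x. fst x = 0) (walk_of j w)) = map fst w"
  using assms
proof (induction w arbitrary: j b)
  case (Cons x w)
  obtain m c where x: "x = (m, c)" by (cases x)
  have c: "c \<or> m < j" and l: "linked ((m, c) # w)"
    using Cons.prems(1) by (auto simp: x linked_Cons2)
  have u: "rev [0..<k] = rev [1..<k] @ [0]" if "k \<ge> 1" for k
    using that by (simp add: upt_rec)
  have "k \<ge> 1 \<Longrightarrow> filter (\<lambda>x. fst x = 0) (map (\<lambda>i. (i, m)) (rev [0..<k])) = [(0, m)]" for k :: nat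
    by (simp add: u filter_map comp_def)
  then have "filter (\<lambda>x. fst x = 0) (segment j x) = [(0, m)]"
    using c Cons.prems(2) by (auto simp: segment_def x)
  then show ?case
    using Cons.IH[OF l] Cons.prems by (simp add: x)
qed simp

lemma snd_walk_of: "x \<in> set (walk_of j w) \<Longrightarrow> snd x \<in> fst ` set w"
  by (induction w arbitrary: j) (auto simp: segment_def)

lemma distinct_segment: "distinct (segment j x)"
  by (auto simp: segment_def distinct_map inj_on_def)

lemma distinct_walk_of: "distinct (map fst w) \<Longrightarrow> distinct (walk_of j w)"
proof (induction w arbitrary: j)
  case (Cons x w)
  have "set (segment j x) \<inter> set (walk_of (fst x) w) = {}"
    using Cons.prems snd_walk_of[of _ "fst x" w] by (force simp: segment_def)
  then show ?case
    using Cons by (simp add: distinct_segment)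
qed simp

lemma distinct_walk_of_iff:
  assumes "linked ((j, b) # w)" "j \<ge> 1" "\<forall>x\<in>set w. fst x \<ge> 1"
  shows "distinct (walk_of j w) \<longleftrightarrow> distinct (map fst w)"
proof
  assume "distinct (walk_of j w)"
  then have "distinct (map snd (filter (\<lambda>x. fst x = 0) (walk_of j w)))"
    by (auto simp: distinct_map inj_on_def)
  then show "distinct (map fst w)"
    using map_snd_filter_walk_of[OF assms] by simp
qed (rule distinct_walk_of)

lemma hd_segment:
  assumes "snd x \<or> fst x < j" "j \<ge> 1"
  shows "segment j x \<noteq> []" "hd (segment j x) = ((if snd x then j else j - fst x) - 1, fst x)"
    "last (segment j x) = (0, fst x)"
  using assms by (auto simp: segment_def hd_map last_map hd_rev last_rev)

text \<open>The first state of a segment determines its letter: it is \<open>(j - 1, m)\<close> for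
  a part and \<open>(j - m - 1, m)\<close> otherwise, and these differ because \<open>m\<close> is
  positive.\<close>

lemma walk_of_inj:
  assumes "linked ((j, b) # w)" "linked ((j, b) # v)" "j \<ge> 1" "\<forall>x\<in>set w. fst x \<ge> 1" "\<forall>x\<in>set v. fst x \<ge> 1"
    "walk_of j w = walk_of j v"
  shows "w = v"
  using assms
proof (induction w arbitrary: j b v)
  case Nil
  then show ?case
    using hd_segment(1) by (cases v) (auto simp: linked_Cons2)
next
  case (Cons x w)
  have x: "snd x \<or> fst x < j" "linked (x # w)"
    using Cons.prems(1) by (auto simp: linked_Cons2)
  from Cons.prems(6) hd_segment(1)[OF x(1) Cons.prems(3)] obtain y v' where v: "v = y # v'"
    by (cases v) auto
  have y: "snd y \<or> fst y < j" "linked (y # v')"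
    using Cons.prems(2) by (auto simp: linked_Cons2 v)
  have "hd (segment j x) = hd (segment j y)"
    using Cons.prems(3,6) hd_segment(1) x(1) y(1) by (metis hd_append2 v walk_of.simps(2))
  then have "x = y"
    using hd_segment(2)[OF x(1) Cons.prems(3)] hd_segment(2)[OF y(1) Cons.prems(3)] x(1) y(1) Cons.prems(3-5) v
    by (cases x; cases y) (auto split: if_splits)
  moreover have "w = v'"
    using Cons.IH[of "fst x" "snd x" v'] Cons.prems x y v \<open>x = y\<close> by simp
  ultimately show ?case
    by (simp add: v)
qed

lemma successively_segment: "successively step (map (\<lambda>i. (i, m)) (rev [0..<k]))" if "m \<ge> 1"
proof (induction k)
  case (Suc k)
  then show ?case
    using that by (cases k) (auto simp: successively_Cons)
qed simp

lemma successively_walk_of: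
  assumes "linked ((j, b) # w)" "j \<ge> 1" "\<forall>x\<in>set w. fst x \<ge> 1"
  shows "successively step ((0, j) # walk_of j w)"
  using assms
proof (induction w arbitrary: j b)
  case (Cons x w)
  have x: "snd x \<or> fst x < j" "linked (x # w)"
    using Cons.prems(1) by (auto simp: linked_Cons2)
  have s: "successively step (segment j x)"
    unfolding segment_def using Cons.prems(3) by (intro successively_segment) simp
  have w: "successively step ((0, fst x) # walk_of (fst x) w)"
    using Cons.IH[of "fst x" "snd x"] x Cons.prems by simp
  have "step (0, j) (hd (segment j x))"
    using hd_segment(2)[OF x(1) Cons.prems(2)] Cons.prems x by auto
  then show ?case
    using s w hd_segment[OF x(1) Cons.prems(2)]
    by (cases "walk_of (fst x) w") (simp_all add: successively_append_iff successively_Cons)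
qed simp

text \<open>As long as the lower index is positive the next state is forced; the condition on the
  last state keeps the walk from ending before index 0 is reached.\<close>

lemma walk_descend:
  assumes "successively step ((a, m) # xs)" "fst (last ((a, m) # xs)) = 0"
  shows "\<exists>ys. xs = map (\<lambda>i. (i, m)) (rev [0..<a]) @ ys \<and> successively step ((0, m) # ys)"
  using assms
proof (induction a arbitrary: xs)
  case 0
  then show ?case by simp
next
  case (Suc a)
  from Suc.prems(2) obtain x xs' where xs: "xs = x # xs'"
    by (cases xs) auto
  then have "x = (a, m)"
    using Suc.prems(1) by (cases x) (simp add: successively_Cons)
  then obtain ys where "xs' = map (\<lambda>i. (i, m)) (rev [0..<a]) @ ys \<and> successively step ((0, m) # ys)"
    using Suc.IH[of xs'] Suc.prems xs by auto
  then show ?case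
    using xs \<open>x = (a, m)\<close> by auto
qed

lemma walk_of_surj:
  assumes "successively step ((0, j) # xs)" "fst (last ((0, j) # xs)) = 0" "j \<ge> 1"
  shows "\<exists>w. xs = walk_of j w \<and> (\<forall>b. linked ((j, b) # w)) \<and> (\<forall>x\<in>set w. fst x \<ge> 1) \<and>
    (w \<noteq> [] \<longrightarrow> last xs = (0, fst (last w)))"
  using assms
proof (induction "length xs" arbitrary: j xs rule: less_induct)
  case less
  show ?case
  proof (cases xs)
    case Nil
    then show ?thesis by (intro exI[of _ "[]"]) (simp add: linked_single)
  next
    case (Cons x xs')
    obtain a m where x: "x = (a, m)" by (cases x)
    have m: "m \<ge> 1" "j = Suc a \<or> j = Suc (a + m)"
      using less.prems(1) by (auto simp: Cons x)
    \<comment> \<open>The ball at height \<open>j\<close> becomes the lower entry if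
      \<open>j = Suc a\<close> and the upper one if \<open>j = Suc (a + m)\<close>. As
      \<open>m\<close> is positive, exactly one case holds, and \<open>c\<close> records
      which.\<close>
    define c where "c = (j = Suc a)"
    obtain ys where ys: "xs' = map (\<lambda>i. (i, m)) (rev [0..<a]) @ ys" "successively step ((0, m) # ys)"
      using walk_descend[of a m xs'] less.prems by (auto simp: Cons x successively_Cons)
    have seg: "segment j (m, c) = map (\<lambda>i. (i, m)) (rev [0..<Suc a])"
      using m unfolding segment_def c_def by auto
    then have xs: "xs = segment j (m, c) @ ys"
      by (simp add: Cons x ys)
    have l: "last (segment j (m, c)) = (0, m)" "segment j (m, c) \<noteq> []"
      using hd_segment[of "(m, c)" j] m less.prems(3) by (auto simp: c_def)
    have "length ys < length xs" "fst (last ((0, m) # ys)) = 0"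
      using less.prems(2) l by (auto simp: xs)
    from less.hyps[OF this(1) ys(2) this(2) m(1)] obtain w where w: "ys = walk_of m w"
      "\<forall>b. linked ((m, b) # w)" "\<forall>x\<in>set w. fst x \<ge> 1" "w \<noteq> [] \<longrightarrow> last ys = (0, fst (last w))"
      by blast
    have "w \<noteq> [] \<Longrightarrow> ys \<noteq> []"
      using w hd_segment(1)[of "hd w" m] m by (cases w) (auto simp: linked_Cons2)
    then show ?thesis
      using w xs l m by (intro exI[of _ "(m, c) # w"]) (auto simp: linked_Cons2 c_def last_append)
  qed
qed

section \<open>Closed walks cut at their largest height\<close>

definition closed_walks :: "(nat \<times> nat) list set" where
  "closed_walks = {xs. xs \<noteq> [] \<and> distinct xs \<and> successively step (last xs # xs)}"

text \<open>Each cycle has exactly one rotation of the following form.\<close>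

definition rooted_walks :: "nat \<Rightarrow> (nat \<times> nat) list set" where
  "rooted_walks M = {xs \<in> closed_walks. last xs = (0, M) \<and> (\<forall>m. (0, m) \<in> set xs \<longrightarrow> m \<le> M)}"

definition all_words :: "nat \<Rightarrow> (nat \<times> bool) list set" where
  "all_words M = {w. w \<noteq> [] \<and> last w = (M, True) \<and> linked ((M, True) # w) \<and>
     distinct (map fst w) \<and> (\<forall>x\<in>set w. 1 \<le> fst x \<and> fst x \<le> M)}"

lemma successively_step_ge:
  "successively step (x # xs) \<Longrightarrow> y \<in> set xs \<Longrightarrow> snd y \<ge> 1"
proof (induction xs arbitrary: x)
  case (Cons z xs)
  then show ?case by (cases x; cases z) auto
qed simp

lemma closed_walks_ge: "xs \<in> closed_walks \<Longrightarrow> x \<in> set xs \<Longrightarrow> snd x \<ge> 1"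
  unfolding closed_walks_def using successively_step_ge by blast

lemma set_map_snd_filter: "(0, m) \<in> set xs \<longleftrightarrow> m \<in> set (map snd (filter (\<lambda>x. fst x = 0) xs))"
  by force

text \<open>The heights of the letters are those of the states \<open>(0, m)\<close> on the walk, so
  distinctness and the bound \<open>M\<close> carry over in both directions.\<close>

lemma bij_betw_walk_of: "bij_betw (walk_of M) (all_words M) (rooted_walks M)"
proof (rule bij_betw_imageI)
  have M: "M \<ge> 1" if "w \<in> all_words M" for w
    using that last_in_set[of w] unfolding all_words_def by force
  show "inj_on (walk_of M) (all_words M)"
    by (rule inj_onI, rule walk_of_inj[of M True]) (use M in \<open>auto simp: all_words_def\<close>)
  show "walk_of M ` all_words M = rooted_walks M"
  proof (rule Set.set_eqI, rule iffI)
    fix xs assume "xs \<in> walk_of M ` all_words M"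
    then obtain w where w: "w \<in> all_words M" "xs = walk_of M w" by blast
    have ww: "linked ((M, True) # w)" "M \<ge> 1" "\<forall>x\<in>set w. fst x \<ge> 1"
      using w M by (auto simp: all_words_def)
    note s = successively_walk_of[OF ww] and f = map_snd_filter_walk_of[OF ww]
    have ne: "w \<noteq> []" "last w = (M, True)" using w by (auto simp: all_words_def)
    have l: "last (walk_of j w) = (0, fst (last w)) \<and> walk_of j w \<noteq> []"
      if "w \<noteq> []" "linked ((j, b) # w)" "j \<ge> 1" "\<forall>x\<in>set w. fst x \<ge> 1" for j b w
      using that
    proof (induction w arbitrary: j b)
      case (Cons x w)
      then have "snd x \<or> fst x < j" "linked (x # w)" by (auto simp: linked_Cons2)
      then show ?case
        using Cons.IH[of "fst x" "snd x"] Cons.prems hd_segment[of x j] by (cases "w = []") auto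
    qed simp
    have "last xs = (0, M)" "xs \<noteq> []"
      using l[OF ne(1) ww] ne by (auto simp: w(2))
    moreover have "distinct xs"
      using w by (auto simp: distinct_walk_of all_words_def)
    moreover have "\<forall>m. (0, m) \<in> set xs \<longrightarrow> m \<le> M"
      unfolding set_map_snd_filter w(2) f using w(1) by (auto simp: all_words_def)
    ultimately show "xs \<in> rooted_walks M"
      using s by (auto simp: rooted_walks_def closed_walks_def w(2))
  next
    fix xs assume r: "xs \<in> rooted_walks M"
    then have xs: "xs \<noteq> []" "distinct xs" "successively step ((0, M) # xs)" "last xs = (0, M)"
      "\<forall>m. (0, m) \<in> set xs \<longrightarrow> m \<le> M" and c: "xs \<in> closed_walks"
      by (auto simp: rooted_walks_def closed_walks_def)
    have M: "M \<ge> 1" using closed_walks_ge[OF c last_in_set[OF xs(1)]] xs(4) by simp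
    obtain w where w: "xs = walk_of M w" "\<And>b. linked ((M, b) # w)" "\<forall>x\<in>set w. fst x \<ge> 1"
      "w \<noteq> [] \<Longrightarrow> last xs = (0, fst (last w))"
      using walk_of_surj[OF xs(3) _ M] xs by auto
    have ne: "w \<noteq> []" using w(1) xs(1) by auto
    have d: "distinct (map fst w)"
      using distinct_walk_of_iff[OF w(2) M w(3)] w(1) xs(2) by simp
    have le: "fst x \<le> M" if "x \<in> set w" for x
      using xs(5) that unfolding set_map_snd_filter w(1) map_snd_filter_walk_of[OF w(2) M w(3)] by auto
    have "fst (last w) = M" using w(4)[OF ne] xs(4) by simp
    \<comment> \<open>A letter that is not a part lies below its predecessor, but no height exceeds
      \<open>M\<close>.\<close>
    moreover have "snd (last w)"
    proof -
      have "successively (\<lambda>x y. snd y \<or> fst y < fst x) (((M, True) # butlast w) @ [last w])"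
        using w(2)[of True] ne by (simp add: linked_def)
      then have "snd (last w) \<or> fst (last w) < fst (last ((M, True) # butlast w))"
        by (subst (asm) successively_append_iff) simp
      moreover have "fst (last ((M, True) # butlast w)) \<le> M"
        using le[OF in_set_butlastD[OF last_in_set]] by simp
      ultimately show ?thesis using \<open>fst (last w) = M\<close> by auto
    qed
    ultimately have "last w = (M, True)" by (cases "last w") auto
    then have "w \<in> all_words M"
      using w ne d le by (auto simp: all_words_def)
    then show "xs \<in> walk_of M ` all_words M"
      using w(1) by blast
  qed
qed

section \<open>Closed walks in the state graph\<close>

definition state :: "nat \<times> nat \<Rightarrow> nat \<Rightarrow> nat" where
  "state x = (\<lambda>i. if i = fst x \<or> i = fst x + snd x then 1 else 0)"

lemma state_eq_1: "{i. state x i = 1} = {fst x, fst x + snd x}"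
  by (auto simp: state_def)

lemma inj_on_state: "inj_on state {x. snd x \<ge> 1}"
proof (rule inj_onI)
  fix x y :: "nat \<times> nat" assume "x \<in> {x. snd x \<ge> 1}" "y \<in> {x. snd x \<ge> 1}" "state x = state y"
  moreover from this have "{fst x, fst x + snd x} = {fst y, fst y + snd y}"
    by (metis state_eq_1)
  ultimately show "x = y"
    by (cases x; cases y) (auto simp: doubleton_eq_iff)
qed

lemma juggling_states_2: "juggling_states 2 = state ` {x. snd x \<ge> 1}"
proof (intro set_eqI iffI)
  fix c assume c: "c \<in> juggling_states 2"
  then have "card {i. c i = 1} = 2" by (simp add: juggling_states_def)
  then obtain i j where "i \<noteq> j" "{i. c i = 1} = {i, j}"
    by (auto simp: card_2_iff)
  then obtain a b where ab: "a < b" "{i. c i = 1} = {a, b}"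
    by (metis insert_commute linorder_neqE_nat)
  have "c = state (a, b - a)"
  proof
    fix i
    have "c i \<in> {0, 1}" using c by (auto simp: juggling_states_def)
    moreover have "c i = 1 \<longleftrightarrow> i = a \<or> i = b" using ab(2) by auto
    ultimately show "c i = state (a, b - a) i"
      using ab(1) by (auto simp: state_def)
  qed
  then show "c \<in> state ` {x. snd x \<ge> 1}"
    using ab(1) by force
next
  fix c assume "c \<in> state ` {x. snd x \<ge> 1}"
  then obtain x where x: "snd x \<ge> 1" "c = state x" by blast
  then show "c \<in> juggling_states 2"
    unfolding juggling_states_def mem_Collect_eq x(2) state_eq_1 by (auto simp: state_def)
qed

text \<open>Time moves every entry down by one index. From lower index 0 only the entry at
  \<open>m\<close> survives, and it may be either entry of the next state; otherwise both survive
  and determine the next state.\<close>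

lemma state_le_iff_step:
  assumes "snd x \<ge> 1" "snd y \<ge> 1"
  shows "(\<forall>i. state y i \<ge> state x (Suc i)) \<longleftrightarrow> step x y"
proof -
  obtain a m b k where xy: "x = (a, m)" "y = (b, k)" by (cases x; cases y)
  have "(\<forall>i. state y i \<ge> state x (Suc i)) \<longleftrightarrow>
      (\<forall>i. Suc i = a \<or> Suc i = a + m \<longrightarrow> i = b \<or> i = b + k)"
    unfolding xy by (simp add: state_def)
  also have "\<dots> \<longleftrightarrow> step x y"
  proof (cases a)
    case 0
    then show ?thesis using assms by (cases m) (simp_all add: xy)
  next
    case (Suc a')
    then have "(\<forall>i. Suc i = a \<or> Suc i = a + m \<longrightarrow> i = b \<or> i = b + k) \<longleftrightarrow>
        (a' = b \<or> a' = b + k) \<and> (a' + m = b \<or> a' + m = b + k)"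
      by (metis Suc_inject add_Suc)
    \<comment> \<open>Two distinct indices lie among two indices, so they agree in increasing
      order.\<close>
    also have "\<dots> \<longleftrightarrow> a' = b \<and> m = k"
      using assms xy by simp linarith
    finally show ?thesis using assms Suc by (auto simp: xy)
  qed
  finally show ?thesis .
qed

lemma state_graph_simps:
  "tail (state_graph b) = fst" "head (state_graph b) = snd" "verts (state_graph b) = juggling_states b"
  "arcs (state_graph b) = {(c, d). c \<in> juggling_states b \<and> d \<in> juggling_states b \<and> (\<forall>i. d i \<ge> c (Suc i))}"
  by (simp_all add: state_graph_def)

lemma arc_iff_step:
  assumes "snd x \<ge> 1"
  shows "(state x, d) \<in> arcs (state_graph 2) \<longleftrightarrow> (\<exists>y. d = state y \<and> step x y)"
proof
  assume "(state x, d) \<in> arcs (state_graph 2)"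
  then obtain y where "snd y \<ge> 1" "d = state y" "\<forall>i. state y i \<ge> state x (Suc i)"
    by (auto simp: state_graph_simps juggling_states_2)
  then show "\<exists>y. d = state y \<and> step x y"
    using state_le_iff_step[OF assms] by blast
next
  assume "\<exists>y. d = state y \<and> step x y"
  then obtain y where y: "d = state y" "step x y" by blast
  then have "snd y \<ge> 1" by (cases x; cases y) auto
  then show "(state x, d) \<in> arcs (state_graph 2)"
    using y assms state_le_iff_step[OF assms] by (auto simp: state_graph_simps juggling_states_2)
qed

text \<open>The tails are the states from \<open>x\<close> on and the heads those of
  \<open>xs\<close>; \<open>zip\<close> drops the last state as a tail.\<close>

definition arcs_from :: "nat \<times> nat \<Rightarrow> (nat \<times> nat) list \<Rightarrow> ((nat \<Rightarrow> nat) \<times> (nat \<Rightarrow> nat)) list" where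
  "arcs_from x xs = zip (map state (x # xs)) (map state xs)"

lemma arcs_from_Cons: "arcs_from x (y # ys) = (state x, state y) # arcs_from y ys"
  by (simp add: arcs_from_def)

lemma arcs_from_Nil: "arcs_from x [] = []"
  by (simp add: arcs_from_def)

lemma map_snd_arcs_from: "map snd (arcs_from x xs) = map state xs"
  by (simp add: arcs_from_def map_snd_zip_take)

lemma length_arcs_from: "length (arcs_from x xs) = length xs"
  by (simp add: arcs_from_def)

lemma awalk_state_graph_iff:
  assumes "snd x \<ge> 1"
  shows "pre_digraph.awalk (state_graph 2) (state x) p v \<longleftrightarrow>
    (\<exists>xs. p = arcs_from x xs \<and> v = state (last (x # xs)) \<and> successively step (x # xs))"
  using assms
proof (induction p arbitrary: x)
  case Nil
  have "[] = arcs_from x xs \<longleftrightarrow> xs = []" for xs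
    by (cases xs) (simp_all add: arcs_from_def)
  moreover have "state x \<in> juggling_states 2"
    using Nil by (simp add: juggling_states_2)
  ultimately show ?case
    by (auto simp: pre_digraph.awalk_def pre_digraph.cas.simps state_graph_simps(3))
next
  case (Cons e p)
  obtain c d where e: "e = (c, d)" by (cases e)
  have vx: "state x \<in> juggling_states 2" using Cons.prems by (simp add: juggling_states_2)
  have vd: "(state x, d) \<in> arcs (state_graph 2) \<Longrightarrow> d \<in> juggling_states 2"
    by (simp add: state_graph_simps)
  have "pre_digraph.awalk (state_graph 2) (state x) (e # p) v \<longleftrightarrow>
      c = state x \<and> (state x, d) \<in> arcs (state_graph 2) \<and> pre_digraph.awalk (state_graph 2) d p v"
    unfolding pre_digraph.awalk_def pre_digraph.cas.simps state_graph_simps(1-3) e fst_conv snd_conv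
      list.set insert_subset
    using vx vd by blast
  also have "\<dots> \<longleftrightarrow> c = state x \<and> (\<exists>y. d = state y \<and> step x y \<and>
      pre_digraph.awalk (state_graph 2) (state y) p v)"
    unfolding arc_iff_step[OF Cons.prems] by metis
  also have "\<dots> \<longleftrightarrow> c = state x \<and> (\<exists>y. d = state y \<and> step x y \<and>
      (\<exists>xs. p = arcs_from y xs \<and> v = state (last (y # xs)) \<and> successively step (y # xs)))"
  proof -
    have "snd y \<ge> 1" if "step x y" for y using that by (cases x; cases y) auto
    then have "step x y \<and> pre_digraph.awalk (state_graph 2) (state y) p v \<longleftrightarrow> step x y \<and>
        (\<exists>xs. p = arcs_from y xs \<and> v = state (last (y # xs)) \<and> successively step (y # xs))" for y
      using Cons.IH[of y] by blast
    then show ?thesis by simp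
  qed
  also have "\<dots> \<longleftrightarrow> (\<exists>y xs. e # p = arcs_from x (y # xs) \<and> v = state (last (x # y # xs)) \<and>
      successively step (x # y # xs))"
    unfolding arcs_from_Cons e successively.simps list.inject prod.inject
      last_ConsR[OF list.distinct(2), of x] by metis
  also have "\<dots> \<longleftrightarrow> (\<exists>xs. e # p = arcs_from x xs \<and> v = state (last (x # xs)) \<and> successively step (x # xs))"
    (is "(\<exists>y xs. ?R (y # xs)) \<longleftrightarrow> (\<exists>xs. ?R xs)")
  proof
    assume "\<exists>xs. ?R xs"
    then obtain xs where xs: "?R xs" by blast
    then obtain y ys where "xs = y # ys" by (cases xs) (simp_all add: arcs_from_Nil)
    then show "\<exists>y xs. ?R (y # xs)" using xs by blast
  qed blast
  finally show ?case .
qed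

text \<open>Turns the distinctness condition in the library's notion of a cycle into distinctness of
  the heads of the arcs.\<close>

lemma tl_awalk_verts:
  assumes "pre_digraph.awalk (state_graph b) u p v"
  shows "tl (pre_digraph.awalk_verts (state_graph b) u p) = map snd p"
proof -
  have "pre_digraph.awalk_verts (state_graph b) u p = u # map snd p"
    if "pre_digraph.cas (state_graph b) u p v" for u
    using that
    by (induction p arbitrary: u)
      (auto simp: pre_digraph.awalk_verts.simps pre_digraph.cas.simps state_graph_simps)
  then show ?thesis
    using assms by (simp add: pre_digraph.awalk_def)
qed

definition arcs_of :: "(nat \<times> nat) list \<Rightarrow> ((nat \<Rightarrow> nat) \<times> (nat \<Rightarrow> nat)) list" where
  "arcs_of xs = arcs_from (last xs) xs"

lemma inj_on_arcs_of: "inj_on arcs_of closed_walks"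
proof (rule inj_onI)
  fix xs ys assume *: "xs \<in> closed_walks" "ys \<in> closed_walks" "arcs_of xs = arcs_of ys"
  then have "map state xs = map state ys"
    unfolding arcs_of_def by (metis map_snd_arcs_from)
  moreover have "inj_on state (set xs \<union> set ys)"
    using * closed_walks_ge by (intro inj_on_subset[OF inj_on_state]) auto
  ultimately show "xs = ys"
    by (rule map_inj_on)
qed

lemma distinct_map_state: "\<forall>x\<in>set xs. snd x \<ge> 1 \<Longrightarrow> distinct (map state xs) \<longleftrightarrow> distinct xs"
  unfolding distinct_map using inj_on_subset[OF inj_on_state] by blast

lemma based_cycles_eq: "based_cycles n 2 = arcs_of ` {xs \<in> closed_walks. length xs = n}"
proof (rule Set.set_eqI, rule iffI)
  fix p assume "p \<in> based_cycles n 2"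
  then obtain u where u: "pre_digraph.awalk (state_graph 2) u p u"
      "distinct (tl (pre_digraph.awalk_verts (state_graph 2) u p))" "p \<noteq> []"
    and n: "length p = n"
    by (auto simp: based_cycles_def pre_digraph.cycle_def)
  have "u \<in> juggling_states 2"
    using u(1) by (simp add: pre_digraph.awalk_def state_graph_simps)
  then obtain x where x: "u = state x" "snd x \<ge> 1"
    by (auto simp: juggling_states_2)
  obtain xs where xs: "p = arcs_from x xs" "state x = state (last (x # xs))" "successively step (x # xs)"
    using u(1) awalk_state_graph_iff[OF x(2)] unfolding x(1) by blast
  have ge: "\<forall>y\<in>set xs. snd y \<ge> 1"
    using successively_step_ge[OF xs(3)] by blast
  have "xs \<noteq> []" using u(3) xs(1) by (auto simp: arcs_from_Nil)
  \<comment> \<open>Closing up is known only for the 0-1 sequences; injectivity of the encoding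
    transfers it to the pairs.\<close>
  then have "x = last xs"
    using inj_onD[OF inj_on_state xs(2)] ge x(2) by auto
  moreover have "distinct xs"
    using u(2) tl_awalk_verts[OF u(1)] distinct_map_state[OF ge] by (simp add: xs(1) map_snd_arcs_from)
  ultimately show "p \<in> arcs_of ` {xs \<in> closed_walks. length xs = n}"
    using xs n \<open>xs \<noteq> []\<close> by (auto simp: closed_walks_def arcs_of_def length_arcs_from)
next
  fix p assume "p \<in> arcs_of ` {xs \<in> closed_walks. length xs = n}"
  then obtain xs where xs: "p = arcs_of xs" "xs \<in> closed_walks" "length xs = n" by blast
  then have c: "xs \<noteq> []" "distinct xs" "successively step (last xs # xs)" by (auto simp: closed_walks_def)
  have ge: "\<forall>y\<in>set xs. snd y \<ge> 1" using closed_walks_ge[OF xs(2)] by blast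
  then have "pre_digraph.awalk (state_graph 2) (state (last xs)) p (state (last xs))"
    using c by (subst awalk_state_graph_iff) (auto simp: xs(1) arcs_of_def)
  moreover have "distinct (map snd p)"
    using c(2) unfolding xs(1) arcs_of_def map_snd_arcs_from distinct_map_state[OF ge] .
  moreover have "p \<noteq> []" "length p = n"
    using c(1) xs by (auto simp: arcs_of_def length_arcs_from simp flip: length_0_conv)
  ultimately show "p \<in> based_cycles n 2"
    using tl_awalk_verts unfolding based_cycles_def pre_digraph.cycle_def by fastforce
qed

section \<open>Rotations and canonical representatives of cycles\<close>

lemma arcs_from_snoc: "arcs_from x (ys @ [y]) = arcs_from x ys @ [(state (last (x # ys)), state y)]"
  by (induction ys arbitrary: x) (auto simp: arcs_from_Cons arcs_from_Nil)

lemma arcs_of_rotate: "arcs_of (rotate k xs) = rotate k (arcs_of xs)"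
proof -
  have "arcs_of (rotate1 xs) = rotate1 (arcs_of xs)" for xs
    by (cases xs) (simp_all add: arcs_of_def arcs_from_Cons arcs_from_Nil arcs_from_snoc)
  then show ?thesis
    by (induction k) simp_all
qed

lemma rotate_closed_walks: "xs \<in> closed_walks \<Longrightarrow> rotate k xs \<in> closed_walks"
proof -
  have "rotate1 xs \<in> closed_walks" if "xs \<in> closed_walks" for xs
  proof (cases xs)
    case (Cons x ys)
    then show ?thesis
      using that by (cases "ys = []")
       (auto simp: closed_walks_def successively_append_iff successively_Cons)
  qed (use that in simp)
  then show "xs \<in> closed_walks \<Longrightarrow> rotate k xs \<in> closed_walks"
    by (induction k) simp_all
qed

lemma cyclic_shift_image: "cyclic_shift `` {p} = range (\<lambda>k. rotate k p)"
  by (auto simp: cyclic_shift_def)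

lemma cyclic_shift_rotate: "cyclic_shift `` {rotate k p} = cyclic_shift `` {p}"
proof -
  \<comment> \<open>Rotation by \<open>k\<close> is undone by \<open>length p * k - k\<close>, which
    is congruent to \<open>-k\<close> modulo the length and not truncated when \<open>p\<close> is
    nonempty.\<close>
  have *: "rotate i p = rotate (i + (length p * k - k)) (rotate k p)" for i
  proof (cases "p = []")
    case False
    then have "i + (length p * k - k) + k = i + length p * k"
      by (cases "length p") auto
    then show ?thesis
      using rotate_conv_mod[of "i + length p * k" p] rotate_conv_mod[of i p]
      unfolding rotate_rotate by (metis mod_mult_self2)
  qed simp
  have "rotate i p \<in> range (\<lambda>i. rotate i (rotate k p))" for i
    by (subst *) (rule rangeI)
  moreover have "rotate i (rotate k p) \<in> range (\<lambda>i. rotate i p)" for i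
    unfolding rotate_rotate by (rule rangeI)
  ultimately show ?thesis
    unfolding cyclic_shift_image by blast
qed

lemma rotate_eq_if_last_eq:
  assumes "distinct xs" "xs \<noteq> []" "last (rotate k xs) = last xs"
  shows "rotate k xs = xs"
proof -
  define n where "n = length xs"
  have n: "n > 0" using assms by (simp add: n_def)
  have "last (rotate k xs) = xs ! ((n - 1 + k) mod n)"
    using assms(2) n by (simp add: last_conv_nth nth_rotate n_def add.commute)
  then have "(n - 1 + k) mod n = n - 1"
    using assms n by (simp add: last_conv_nth n_def nth_eq_iff_index_eq)
  then have "(n - 1 + k) mod n = (n - 1) mod n"
    using n by simp
  then have "k mod n = 0"
    by (subst (asm) mod_eq_dvd_iff_nat) auto
  then show ?thesis
    by (metis id_apply n_def rotate0 rotate_conv_mod)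
qed

lemma rotate_to_last:
  assumes "x \<in> set xs"
  shows "\<exists>k. last (rotate k xs) = x"
proof -
  obtain ys zs where "xs = ys @ x # zs" using assms by (meson split_list)
  then have "rotate (length (ys @ [x])) xs = zs @ ys @ [x]"
    using rotate_append[of "ys @ [x]" zs] by simp
  then show ?thesis by (intro exI[of _ "length (ys @ [x])"]) simp
qed

text \<open>A state of minimal lower index must have index 0, since from a positive index the next
  step would lower it.\<close>

lemma closed_walks_throw:
  assumes "xs \<in> closed_walks"
  shows "\<exists>m. (0, m) \<in> set xs"
proof -
  have ne: "xs \<noteq> []" using assms by (simp add: closed_walks_def)
  define a where "a = Min (fst ` set xs)"
  have "a \<in> fst ` set xs" unfolding a_def using ne by (intro Min_in) simp_all
  then obtain y where y: "a = fst y" "y \<in> set xs" by (rule imageE)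
  define m where "m = snd y"
  have m: "(a, m) \<in> set xs" using y by (simp add: m_def)
  \<comment> \<open>With the minimal state rotated to the end, its successor is the head of the
    list.\<close>
  from rotate_to_last[OF m] obtain k where k: "last (rotate k xs) = (a, m)" ..
  obtain x ys where r: "rotate k xs = x # ys" using ne by (cases "rotate k xs") auto
  have "step (a, m) x"
    using rotate_closed_walks[OF assms, of k] k r by (auto simp: closed_walks_def)
  moreover have "x \<in> set xs"
    using arg_cong[OF r, of set] by simp
  then have "a \<le> fst x" unfolding a_def by simp
  ultimately have "a = 0" by (cases x) (auto split: if_splits)
  then show ?thesis using m by blast
qed

lemma rooted_walks_rotate:
  assumes "xs \<in> closed_walks"
  shows "\<exists>k M. rotate k xs \<in> rooted_walks M"
proof -
  have f: "finite {m. (0, m) \<in> set xs}"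
    by (rule finite_subset[of _ "snd ` set xs"]) (auto intro: rev_image_eqI)
  define M where "M = Max {m. (0, m) \<in> set xs}"
  have "(0, M) \<in> set xs"
    using Max_in[OF f] closed_walks_throw[OF assms] unfolding M_def by blast
  from rotate_to_last[OF this] obtain k where "last (rotate k xs) = (0, M)" ..
  moreover have "\<forall>m. (0, m) \<in> set xs \<longrightarrow> m \<le> M"
    unfolding M_def using Max_ge[OF f] by blast
  ultimately have "rotate k xs \<in> rooted_walks M"
    using rotate_closed_walks[OF assms] by (simp add: rooted_walks_def)
  then show ?thesis by blast
qed

text \<open>Each cyclic class contains exactly one rooted walk, because the state
  \<open>(0, M)\<close> with the largest \<open>M\<close> occurs once on the cycle and fixes the
  rotation.\<close>

lemma num_prime_juggling_patterns_2:
  "num_prime_juggling_patterns n 2 = card {xs. \<exists>M. xs \<in> rooted_walks M \<and> length xs = n}"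
proof -
  let ?R = "{xs. \<exists>M. xs \<in> rooted_walks M \<and> length xs = n}"
  let ?f = "\<lambda>xs. cyclic_shift `` {arcs_of xs}"
  have "bij_betw ?f ?R (prime_juggling_patterns n 2)"
  proof (rule bij_betw_imageI)
    show "inj_on ?f ?R"
    proof (rule inj_onI)
      fix xs ys assume "xs \<in> ?R" "ys \<in> ?R" and e: "?f xs = ?f ys"
      then obtain M N where r: "xs \<in> rooted_walks M" "ys \<in> rooted_walks N" by blast
      have c: "xs \<in> closed_walks" "ys \<in> closed_walks"
        using r by (auto simp: rooted_walks_def)
      have "arcs_of ys \<in> ?f ys" unfolding cyclic_shift_image by (metis rangeI rotate0 id_apply)
      then have "arcs_of ys \<in> ?f xs"
        unfolding e .
      then obtain k where "arcs_of ys = arcs_of (rotate k xs)"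
        unfolding cyclic_shift_image arcs_of_rotate by (rule rangeE)
      then have ys: "ys = rotate k xs"
        using inj_onD[OF inj_on_arcs_of] c rotate_closed_walks by blast
      have M: "(0, M) \<in> set xs" "(0, N) \<in> set ys"
        using r c last_in_set[of xs] last_in_set[of ys] by (simp_all add: rooted_walks_def closed_walks_def)
      \<comment> \<open>Both are the largest height on the same set of states.\<close>
      then have "M = N"
        using r ys by (auto simp: rooted_walks_def intro!: antisym)
      then have "last (rotate k xs) = last xs"
        using r ys by (simp add: rooted_walks_def)
      then show "xs = ys"
        using rotate_eq_if_last_eq[of xs k] c ys by (simp add: closed_walks_def)
    qed
    show "?f ` ?R = prime_juggling_patterns n 2"
    proof (intro equalityI subsetI)
      fix X assume "X \<in> ?f ` ?R"
      then show "X \<in> prime_juggling_patterns n 2"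
        by (auto simp: prime_juggling_patterns_def based_cycles_eq rooted_walks_def intro!: quotientI)
    next
      fix X assume "X \<in> prime_juggling_patterns n 2"
      then obtain xs where xs: "xs \<in> closed_walks" "length xs = n" "X = ?f xs"
        by (auto simp: prime_juggling_patterns_def based_cycles_eq elim!: quotientE)
      then obtain k M where "rotate k xs \<in> rooted_walks M"
        using rooted_walks_rotate by blast
      moreover have "X = ?f (rotate k xs)"
        unfolding xs(3) arcs_of_rotate cyclic_shift_rotate ..
      ultimately show "X \<in> ?f ` ?R"
        using xs(2) by (intro image_eqI[of _ _ "rotate k xs"]) auto
    qed
  qed
  then show ?thesis
    by (simp add: num_prime_juggling_patterns_def bij_betw_same_card)
qed

section \<open>Summation over partitions\<close>

lemma words_one:
  assumes "P \<subseteq> {1..}"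
  shows "words M P 1 = {w \<in> all_words M. {m. (m, True) \<in> set w} = P}"
proof (intro Set.set_eqI iffI)
  fix w assume w: "w \<in> words M P 1"
  then show "w \<in> {w \<in> all_words M. {m. (m, True) \<in> set w} = P}"
    using words_ge[OF w assms] by (auto simp: words_def all_words_def)
next
  fix w assume "w \<in> {w \<in> all_words M. {m. (m, True) \<in> set w} = P}"
  then show "w \<in> words M P 1"
    unfolding words_def all_words_def by fastforce
qed

text \<open>The word starts from height \<open>M\<close> and ends there, so the outer terms of
  \<open>length_walk_of\<close> cancel.\<close>

lemma length_walk_of_all_words:
  assumes "w \<in> all_words M"
  shows "length (walk_of M w) = \<Sum>{m. (m, True) \<in> set w}"
proof -
  have w: "linked ((M, True) # w)" "w \<noteq> []" "last w = (M, True)" "distinct (map fst w)"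
    using assms by (auto simp: all_words_def)
  have "length (walk_of M w) = sum_list (map fst (filter snd w))"
    using length_walk_of[OF w(1,2)] w(3) by simp
  also have "\<dots> = \<Sum>(set (map fst (filter snd w)))"
    using w(4) by (metis distinct_map_filter distinct_sum_list_conv_Sum)
  also have "set (map fst (filter snd w)) = {m. (m, True) \<in> set w}"
    by force
  finally show ?thesis .
qed

lemma sorted_wrt_greater_unique:
  fixes p q :: "nat list"
  assumes "sorted_wrt (>) p" "sorted_wrt (>) q" "set p = set q"
  shows "p = q"
proof -
  have "sorted_wrt (<) (rev p)" "sorted_wrt (<) (rev q)"
    using assms by (simp_all add: sorted_wrt_rev)
  then have "rev p = rev q"
    using assms(3) strict_sorted_equal by (metis set_rev)
  then show ?thesis by simp
qed

lemma sorted_wrt_greater_exists: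
  assumes "finite (P :: nat set)"
  shows "\<exists>p. sorted_wrt (>) p \<and> set p = P"
  using assms
  by (intro exI[of _ "rev (sorted_list_of_set P)"]) (simp add: sorted_wrt_rev)

lemma hd_eq_Max:
  assumes "sorted_wrt (>) p" "p \<noteq> []"
  shows "hd p = Max (set p)"
  using assms by (cases p) (auto intro!: Max_eqI[symmetric])

definition all_distinct_partitions :: "nat \<Rightarrow> nat list set" where
  "all_distinct_partitions n = {p. sorted_wrt (>) p \<and> (\<forall>x\<in>set p. x \<ge> 1) \<and> sum_list p = n}"

lemma length_le_sum_list: "(\<forall>x\<in>set p. x \<ge> 1) \<Longrightarrow> length p \<le> sum_list p" for p :: "nat list"
  by (induction p) auto

lemma finite_all_distinct_partitions: "finite (all_distinct_partitions n)"
proof (rule finite_subset)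
  show "all_distinct_partitions n \<subseteq> {p. set p \<subseteq> {..n} \<and> length p \<le> n}"
    using length_le_sum_list member_le_sum_list by (fastforce simp: all_distinct_partitions_def)
qed (simp add: finite_lists_length_le)

text \<open>The partition is recovered from the word by listing its parts in decreasing order; its
  head is the root height, and its sum is the length of the walk.\<close>

lemma rooted_walks_bij:
  assumes "n \<ge> 1"
  shows "bij_betw (\<lambda>(p, w). walk_of (hd p) w)
    (SIGMA p:all_distinct_partitions n. words (hd p) (set p) 1)
    {xs. \<exists>M. xs \<in> rooted_walks M \<and> length xs = n}"
proof (rule bij_betw_imageI)
  have part: "w \<in> all_words (hd p) \<and> {m. (m, True) \<in> set w} = set p"
    if "p \<in> all_distinct_partitions n" "w \<in> words (hd p) (set p) 1" for p w
    using words_one[of "set p" "hd p"] that by (auto simp: all_distinct_partitions_def)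
  have rooted: "walk_of M w \<in> rooted_walks M" if "w \<in> all_words M" for M w
    using that bij_betw_walk_of[of M] by (auto simp: bij_betw_def)
  show "inj_on (\<lambda>(p, w). walk_of (hd p) w) (SIGMA p:all_distinct_partitions n. words (hd p) (set p) 1)"
  proof (rule inj_onI, clarify)
    fix p v q w
    assume p: "p \<in> all_distinct_partitions n" "v \<in> words (hd p) (set p) 1"
      and q: "q \<in> all_distinct_partitions n" "w \<in> words (hd q) (set q) 1"
      and e: "walk_of (hd p) v = walk_of (hd q) w"
    note pp = part[OF p] and qq = part[OF q]
    have "hd p = hd q"
      using rooted[of v "hd p"] rooted[of w "hd q"] pp qq e by (simp add: rooted_walks_def)
    moreover from this have vw: "v = w"
      using bij_betw_walk_of[of "hd p"] pp qq e by (auto simp: bij_betw_def dest: inj_onD)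
    then have "p = q"
      using pp qq p q by (intro sorted_wrt_greater_unique) (auto simp: all_distinct_partitions_def)
    ultimately show "p = q \<and> v = w" using vw by simp
  qed
  show "(\<lambda>(p, w). walk_of (hd p) w) ` (SIGMA p:all_distinct_partitions n. words (hd p) (set p) 1)
      = {xs. \<exists>M. xs \<in> rooted_walks M \<and> length xs = n}" (is "?L = ?R")
  proof (intro equalityI subsetI)
    fix xs assume "xs \<in> ?L"
    then obtain p w where p: "p \<in> all_distinct_partitions n" "w \<in> words (hd p) (set p) 1"
      and xs: "xs = walk_of (hd p) w" by auto
    have "\<Sum>(set p) = n"
      using p(1) sorted_wrt_greater_distinct by (auto simp: all_distinct_partitions_def distinct_sum_list_conv_Sum)
    then show "xs \<in> ?R"
      using part[OF p] rooted length_walk_of_all_words[of w "hd p"] unfolding xs by auto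
  next
    fix xs assume "xs \<in> ?R"
    then obtain M where M: "xs \<in> rooted_walks M" "length xs = n" by blast
    then obtain w where w: "w \<in> all_words M" "xs = walk_of M w"
      using bij_betw_walk_of[of M] by (auto simp: bij_betw_def)
    let ?P = "{m. (m, True) \<in> set w}"
    have "finite ?P"
      by (rule finite_subset[of _ "fst ` set w"]) (auto intro: rev_image_eqI)
    then obtain p where p: "sorted_wrt (>) p" "set p = ?P"
      using sorted_wrt_greater_exists by blast
    have MP: "M \<in> ?P" and le: "\<forall>m\<in>?P. 1 \<le> m \<and> m \<le> M"
      using w(1) last_in_set[of w] by (auto simp: all_words_def)
    then have "p \<noteq> []" using p by auto
    then have hd: "hd p = M"
      unfolding hd_eq_Max[OF p(1) \<open>p \<noteq> []\<close>] p(2) using MP le \<open>finite ?P\<close> by (intro Max_eqI) auto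
    have "sum_list p = n"
      using length_walk_of_all_words[OF w(1)] M(2) w(2) p sorted_wrt_greater_distinct
      by (metis distinct_sum_list_conv_Sum)
    then have "p \<in> all_distinct_partitions n"
      using p le by (simp add: all_distinct_partitions_def)
    moreover have "w \<in> words (hd p) (set p) 1"
      using words_one[of "set p" M] le w(1) p(2) hd by auto
    ultimately show "xs \<in> ?L"
      using w(2) hd by (intro image_eqI[of _ _ "(p, w)"]) auto
  qed
qed

theorem theorem2p5:
  fixes n :: nat
  assumes "n \<ge> 1"
  shows "real (num_prime_juggling_patterns n 2) =
    (\<Sum>\<^sub>\<infinity>t\<in>{1..}. \<Sum>p\<in>distinct_partitions n t.
        1 / (real t * (real t + 1)) * (\<Prod>i=1..t. ((real i + 1) / real i) ^ (p ! (i - 1))))"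
proof -
  let ?D = "all_distinct_partitions n"
  let ?f = "\<lambda>p. 1 / (real (length p) * (real (length p) + 1)) * weight p"
  have D: "p \<noteq> []" "sorted_wrt (>) p" "\<forall>x\<in>set p. x \<ge> 1" if "p \<in> ?D" for p
    using that assms by (auto simp: all_distinct_partitions_def)
  \<comment> \<open>At \<open>k = 1\<close> no height is left undecided and the power in
    \<open>card_words\<close> is 1.\<close>
  have c: "finite (words (hd p) (set p) 1)" "real (card (words (hd p) (set p) 1)) = ?f p" if "p \<in> ?D" for p
    using card_words[of p 1] D[OF that] last_in_set[of p] by auto
  have len: "length p \<in> {1..n}" if "p \<in> ?D" for p
    using that D(1)[OF that] length_le_sum_list[of p] by (cases p) (auto simp: all_distinct_partitions_def)
  have dp: "distinct_partitions n t = {p \<in> ?D. length p = t}" for t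
    by (auto simp: distinct_partitions_def all_distinct_partitions_def)
  have "num_prime_juggling_patterns n 2 = card (SIGMA p:?D. words (hd p) (set p) 1)"
    unfolding num_prime_juggling_patterns_2 using bij_betw_same_card[OF rooted_walks_bij[OF assms]] by simp
  also have "\<dots> = (\<Sum>p\<in>?D. card (words (hd p) (set p) 1))"
    using c(1) finite_all_distinct_partitions by (intro card_SigmaI) auto
  finally have "real (num_prime_juggling_patterns n 2) = (\<Sum>p\<in>?D. ?f p)"
    using c(2) by simp
  also have "\<dots> = (\<Sum>t\<in>{1..n}. \<Sum>p\<in>distinct_partitions n t. ?f p)"
    unfolding dp using len finite_all_distinct_partitions by (intro sum.group[symmetric]) auto
  also have "\<dots> = (\<Sum>\<^sub>\<infinity>t\<in>{1..n}. \<Sum>p\<in>distinct_partitions n t. ?f p)"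
    by simp
  also have "\<dots> = (\<Sum>\<^sub>\<infinity>t\<in>{1..}. \<Sum>p\<in>distinct_partitions n t.
        1 / (real t * (real t + 1)) * (\<Prod>i=1..t. ((real i + 1) / real i) ^ (p ! (i - 1))))"
  \<comment> \<open>More than \<open>n\<close> positive parts cannot sum to \<open>n\<close>, so the
    infinite sum has only zero terms beyond \<open>n\<close>.\<close>
  proof (rule infsum_cong_neutral)
    fix t assume "t \<in> {1..} - {1..n}"
    then have "distinct_partitions n t = {}"
      using len by (auto simp: dp)
    then show "(\<Sum>p\<in>distinct_partitions n t.
        1 / (real t * (real t + 1)) * (\<Prod>i=1..t. ((real i + 1) / real i) ^ (p ! (i - 1)))) = 0"
      by simp
  next
    fix t
    show "(\<Sum>p\<in>distinct_partitions n t. ?f p) = (\<Sum>p\<in>distinct_partitions n t.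
        1 / (real t * (real t + 1)) * (\<Prod>i=1..t. ((real i + 1) / real i) ^ (p ! (i - 1))))"
      by (rule sum.cong) (auto simp: dp weight_def)
  qed auto
  finally show ?thesis .
qed

end
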